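(* Let $\sigma:N\to M$ be a mapping onto $M$. If $m\in\mathcal{K}(N)$ then $T_{\sigma_{-1}}(m)\in\mathcal{K}(M)$, and the independency model induced by $T_{\sigma_{-1}}(m)$ is given by $$a\perp b\mid C\ [T_{\sigma_{-1}}(m)]\iff \sigma_{-1}(a)\perp\sigma_{-1}(b)\mid\sigma_{-1}(C)\ [m]\qquad\text{for any }\langle a,b|C\rangle\in\mathcal{E}(M).$$ In particular, given $s\in S\subseteq N$, the contraction $T_{S\to s}$ maps $\mathcal{K}(N)$ to $\mathcal{K}(N')$, where $N'=(N\setminus S)\cup s\subseteq N$.
   Context: $N$ and $M$ are finite non-empty sets, $|N|\ge 2$; $\mathcal{P}(N)$ is the power set of $N$; a singleton $\{a\}$ is written $a$. $\mathbb{R}^{\mathcal{P}(N)}$ is the space of functions $m:\mathcal{P}(N)\to\mathbb{R}$. A function $m$ is supermodular if $m(A)+m(B)\le m(A\cup B)+m(A\cap B)$ for all $A,B\subseteq N$; $\mathcal{K}(N)$ is the cone of supermodular functions. $\mathcal{E}(N)$ is the set of triplets $\langle a,b|C\rangle$ with $a,b\in N$ distinct and $C\subseteq N\setminus\{a,b\}$. For $m\in\mathbb{R}^{\mathcal{P}(N)}$ and pairwise disjoint $A,B,C\subseteq N$, $A\perp B\mid C\ [m]$ means $m(A\cup B\cup C)+m(C)-m(A\cup C)-m(B\cup C)=0$; the independency model induced by $m\in\mathcal{K}(N)$ is the set of $\langle a,b|C\rangle\in\mathcal{E}(N)$ with $a\perp b\mid C\ [m]$. The same definitions are used for other finite sets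 in place of $N$. For a surjection $\sigma:N\to M$ and $T\subseteq M$, $\sigma_{-1}(T)=\{i\in N:\sigma(i)\in T\}$ is the pre-image. The coarsening transformation is $T_{\sigma_{-1}}:\mathbb{R}^{\mathcal{P}(N)}\to\mathbb{R}^{\mathcal{P}(M)}$, $[T_{\sigma_{-1}}(m)](T)=m(\sigma_{-1}(T))$ for $T\subseteq M$. Given $s\in S\subseteq N$ and $N'=(N\setminus S)\cup s$, the contraction $T_{S\to s}:\mathbb{R}^{\mathcal{P}(N)}\to\mathbb{R}^{\mathcal{P}(N')}$ is the coarsening transformation determined by $\sigma:N\to N'$ with $\sigma(t)=s$ for $t\in S$ and $\sigma(t)=t$ for $t\in N\setminus S$. *)

theory Defs
  imports Complex_Main "HOL-Library.FuncSet"
begin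

text \<open>
  Base sets are explicit carriers. The space of real functions on the power set of
  \<open>N\<close> is \<open>Pow N \<rightarrow>\<^sub>E UNIV\<close>, so its elements are \<open>undefined\<close> outside \<open>Pow N\<close> and
  are determined by their values on subsets of \<open>N\<close>.
\<close>

definition supermodular_cone :: "'a set \<Rightarrow> ('a set \<Rightarrow> real) set" where
  "supermodular_cone N =
     {m \<in> Pow N \<rightarrow>\<^sub>E UNIV.
        \<forall>A B. A \<subseteq> N \<longrightarrow> B \<subseteq> N \<longrightarrow> m A + m B \<le> m (A \<union> B) + m (A \<inter> B)}"

definition elementary_triplets :: "'a set \<Rightarrow> ('a \<times> 'a \<times> 'a set) set" where
  "elementary_triplets N =
     {(a, b, C). a \<in> N \<and> b \<in> N \<and> a \<noteq> b \<and> C \<subseteq> N - {a, b}}"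

text \<open>
  The relation is meant only for pairwise disjoint subsets of \<open>N\<close>; this proviso is part
  of the definition, and the relation is false for all other arguments.
\<close>

definition cond_indep ::
    "'a set \<Rightarrow> ('a set \<Rightarrow> real) \<Rightarrow> 'a set \<Rightarrow> 'a set \<Rightarrow> 'a set \<Rightarrow> bool" where
  "cond_indep N m A B C \<longleftrightarrow>
     A \<subseteq> N \<and> B \<subseteq> N \<and> C \<subseteq> N \<and> A \<inter> B = {} \<and> A \<inter> C = {} \<and> B \<inter> C = {} \<and>
     m (A \<union> B \<union> C) + m C - m (A \<union> C) - m (B \<union> C) = 0"

definition indep_model :: "'a set \<Rightarrow> ('a set \<Rightarrow> real) \<Rightarrow> ('a \<times> 'a \<times> 'a set) set" where
  "indep_model N m = {(a, b, C) \<in> elementary_triplets N. cond_indep N m {a} {b} C}"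

definition preimage :: "'a set \<Rightarrow> ('a \<Rightarrow> 'b) \<Rightarrow> 'b set \<Rightarrow> 'a set" where
  "preimage N \<sigma> T = {i \<in> N. \<sigma> i \<in> T}"

definition coarsening ::
    "'a set \<Rightarrow> 'b set \<Rightarrow> ('a \<Rightarrow> 'b) \<Rightarrow> ('a set \<Rightarrow> real) \<Rightarrow> ('b set \<Rightarrow> real)" where
  "coarsening N M \<sigma> m = (\<lambda>T\<in>Pow M. m (preimage N \<sigma> T))"

definition contraction ::
    "'a set \<Rightarrow> 'a set \<Rightarrow> 'a \<Rightarrow> ('a set \<Rightarrow> real) \<Rightarrow> ('a set \<Rightarrow> real)" where
  "contraction N S s = coarsening N ((N - S) \<union> {s}) (\<lambda>t. if t \<in> S then s else t)"

end

theory Submission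
  imports Defs
begin

text \<open>Taking preimages under \<sigma> commutes with union and intersection and sends the empty
  set to itself, and the coarsened function is m composed with it. Hence any relation among values
  of \<open>coarsening N M \<sigma> m\<close> at sets built by union and intersection is the same
  relation for m at the preimages. Applied to the supermodular inequality this gives
  \<open>coarsening_supermodular\<close>; applied to the equation defining independence it gives
  \<open>cond_indep_coarsening_iff\<close>. A contraction is the coarsening along the map that
  collapses S to s.\<close>

lemma preimage_Un: "preimage N \<sigma> (A \<union> B) = preimage N \<sigma> A \<union> preimage N \<sigma> B"
  by (auto simp: preimage_def)

lemma preimage_Int: "preimage N \<sigma> (A \<inter> B) = preimage N \<sigma> A \<inter> preimage N \<sigma> B"
  by (auto simp: preimage_def)

lemma preimage_empty: "preimage N \<sigma> {} = {}"
  by (simp add: preimage_def)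

lemma preimage_subset: "preimage N \<sigma> T \<subseteq> N"
  by (auto simp: preimage_def)

lemma coarsening_apply: "T \<subseteq> M \<Longrightarrow> coarsening N M \<sigma> m T = m (preimage N \<sigma> T)"
  by (simp add: coarsening_def)

text \<open>The inequality for A and B is the one that m satisfies at their preimages.\<close>

lemma coarsening_supermodular:
  assumes "m \<in> supermodular_cone N"
  shows "coarsening N M \<sigma> m \<in> supermodular_cone M"
  unfolding supermodular_cone_def
proof (intro CollectI conjI allI impI)
  show "coarsening N M \<sigma> m \<in> Pow M \<rightarrow>\<^sub>E UNIV"
    by (simp add: coarsening_def)
next
  fix A B assume "A \<subseteq> M" "B \<subseteq> M"
  \<comment> \<open>These are side conditions of \<open>coarsening_apply\<close>: outside
    \<open>Pow M\<close> a coarsening is \<open>undefined\<close>.\<close>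
  then have "A \<union> B \<subseteq> M" "A \<inter> B \<subseteq> M" by auto
  with \<open>A \<subseteq> M\<close> \<open>B \<subseteq> M\<close> assms
  show "coarsening N M \<sigma> m A + coarsening N M \<sigma> m B
      \<le> coarsening N M \<sigma> m (A \<union> B) + coarsening N M \<sigma> m (A \<inter> B)"
    by (simp add: supermodular_cone_def coarsening_apply preimage_Un preimage_Int preimage_subset)
qed

text \<open>Preimages of disjoint sets are disjoint, so the provisos in \<open>cond_indep\<close>
  hold on both sides, and what remains is one and the same equation in m.\<close>

lemma cond_indep_coarsening_iff:
  assumes "A \<subseteq> M" "B \<subseteq> M" "C \<subseteq> M" "A \<inter> B = {}" "A \<inter> C = {}" "B \<inter> C = {}"
  shows "cond_indep M (coarsening N M \<sigma> m) A B C \<longleftrightarrow>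
    cond_indep N m (preimage N \<sigma> A) (preimage N \<sigma> B) (preimage N \<sigma> C)"
proof -
  have "A \<union> B \<union> C \<subseteq> M" "A \<union> C \<subseteq> M" "B \<union> C \<subseteq> M" using assms by auto
  then show ?thesis
    using assms unfolding cond_indep_def
    \<comment> \<open>Unions are pushed out of \<open>preimage\<close>, but intersections are folded
      back in: there the assumptions turn them into the empty set, which settles
      disjointness.\<close>
    by (simp only: coarsening_apply preimage_Un preimage_subset preimage_Int [symmetric]
        preimage_empty simp_thms)
qed

text \<open>Being an elementary triplet provides exactly the inclusions and disjointness that the
  general equivalence asks of {a}, {b} and C.\<close>

lemma cond_indep_coarsening_elementary:
  assumes "(a, b, C) \<in> elementary_triplets M"
  shows "cond_indep M (coarsening N M \<sigma> m) {a} {b} C \<longleftrightarrow>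
    cond_indep N m (preimage N \<sigma> {a}) (preimage N \<sigma> {b}) (preimage N \<sigma> C)"
  by (rule cond_indep_coarsening_iff) (use assms in \<open>auto simp: elementary_triplets_def\<close>)

lemma indep_model_coarsening:
  "indep_model M (coarsening N M \<sigma> m) =
    {(a, b, C) \<in> elementary_triplets M.
      cond_indep N m (preimage N \<sigma> {a}) (preimage N \<sigma> {b}) (preimage N \<sigma> C)}"
  unfolding indep_model_def by (auto simp: cond_indep_coarsening_elementary)

lemma contraction_supermodular:
  "contraction N S s \<in> supermodular_cone N \<rightarrow> supermodular_cone ((N - S) \<union> {s})"
  unfolding contraction_def by (intro funcsetI coarsening_supermodular)

theorem mainTheorem6:
  fixes N :: "'a set"
  assumes "finite N" and "card N \<ge> 2"
  shows "(\<forall>(M :: 'b set) (\<sigma> :: 'a \<Rightarrow> 'b).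
            finite M \<longrightarrow> M \<noteq> {} \<longrightarrow> \<sigma> ` N = M \<longrightarrow>
            (\<forall>m \<in> supermodular_cone N.
               coarsening N M \<sigma> m \<in> supermodular_cone M \<and>
               indep_model M (coarsening N M \<sigma> m) =
                 {(a, b, C) \<in> elementary_triplets M.
                    cond_indep N m (preimage N \<sigma> {a}) (preimage N \<sigma> {b}) (preimage N \<sigma> C)} \<and>
               (\<forall>(a, b, C) \<in> elementary_triplets M.
                  cond_indep M (coarsening N M \<sigma> m) {a} {b} C \<longleftrightarrow>
                  cond_indep N m (preimage N \<sigma> {a}) (preimage N \<sigma> {b}) (preimage N \<sigma> C))))
         \<and> (\<forall>S s. s \<in> S \<longrightarrow> S \<subseteq> N \<longrightarrow>
              contraction N S s \<in> supermodular_cone N \<rightarrow> supermodular_cone ((N - S) \<union> {s}))"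
  \<comment> \<open>With \<open>Un_insert_right\<close> active, the base set
    \<open>(N - S) \<union> {s}\<close> would be rewritten to an \<open>insert\<close> and
    \<open>contraction_supermodular\<close> would no longer match.\<close>
  by (auto simp: coarsening_supermodular indep_model_coarsening
      cond_indep_coarsening_elementary contraction_supermodular simp del: Un_insert_right)

end
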